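(* Let $k \geq 1$, let $H$ be a subgraph of the cube with a $k$-partite representation $\mathcal{H}$, and let $\alpha>0$ be such that $\mathrm{ex}(K_n^{(k)}, \mathcal{H}) \leq \alpha n^k$ for all $n$. Then \[\mathrm{ex}(Q_n, H) = O(\alpha^{1/k} 2^n n),\] that is, there is a constant $C$ depending only on $k$ such that $\mathrm{ex}(Q_n,H) \leq C\alpha^{1/k}2^n n$ for all sufficiently large $n$.
   Context: The hypercube $Q_n$ is the graph with vertex set $\{0,1\}^n$, two vertices being adjacent if they differ in exactly one coordinate. $K_n^{(k)}$ denotes the complete $k$-uniform hypergraph on $n$ vertices. For (hyper)graphs $G$ and $H$, $\mathrm{ex}(G,H)$ is the maximum number of edges in a sub(hyper)graph of $G$ containing no copy of $H$. An edge of $Q_l$ is written as a string $[a_1 \dots a_l]$ with exactly one entry equal to $*$ (the flip-bit) and all other entries in $\{0,1\}$; it joins the two vertices obtained by replacing $*$ by $0$ and by $1$. The non-zero bits of an edge are the positions whose entry is $1$ or $*$. A subgraph $H$ of the cube has a $k$-partite representation if there is an $l$ such that: $H$ is (embedded as) a subgraph of $Q_l$; every edge of $H$ has exactly $k$ non-zero bits ($k-1$ ones and the flip-bit); and there is a function $\sigma:[l]\to[k]$ such that for each edge $e$ of $H$, $\sigma$ maps the set of positions of the non-zero bits of $e$ onto $[k]$. The representation $\mathcal{H}$ is the $k$-uniform hypergraph on vertex set $[l]$ whose edges are the sets of positions of non-zero bits of the edges of $H$. *)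

theory Defs
  imports Complex_Main "HOL-Library.FuncSet"
begin

text \<open>A hypergraph is a pair of a vertex set and a set of edges, each edge being a set of
  vertices. Graphs are the case where all edges have two elements, so that the extremal
  number below is the same notion for the cube and for uniform hypergraphs.\<close>

type_synonym 'a hypergraph = "'a set \<times> 'a set set"

abbreviation verts :: "'a hypergraph \<Rightarrow> 'a set" where
  "verts G \<equiv> fst G"

abbreviation edges :: "'a hypergraph \<Rightarrow> 'a set set" where
  "edges G \<equiv> snd G"

definition subhypergraph :: "'a hypergraph \<Rightarrow> 'a hypergraph \<Rightarrow> bool" where
  "subhypergraph F G \<longleftrightarrow>
     verts F \<subseteq> verts G \<and> edges F \<subseteq> edges G \<and> (\<forall>e\<in>edges F. e \<subseteq> verts F)"

text \<open>Copies are not required to be induced.\<close>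

definition embedding :: "('a \<Rightarrow> 'b) \<Rightarrow> 'a hypergraph \<Rightarrow> 'b hypergraph \<Rightarrow> bool" where
  "embedding f H F \<longleftrightarrow>
     inj_on f (verts H) \<and> f ` verts H \<subseteq> verts F \<and> (\<forall>e\<in>edges H. f ` e \<in> edges F)"

definition contains_copy :: "'b hypergraph \<Rightarrow> 'a hypergraph \<Rightarrow> bool" where
  "contains_copy F H \<longleftrightarrow> (\<exists>f. embedding f H F)"

text \<open>For finite \<open>G\<close> the supremum is a maximum over a finite set. That set is empty only
  if \<open>H\<close> has no vertices, in which case the value is 0.\<close>

definition ex_number :: "'b hypergraph \<Rightarrow> 'a hypergraph \<Rightarrow> nat" where
  "ex_number G H = Sup {card (edges F) |F. subhypergraph F G \<and> \<not> contains_copy F H}"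

definition complete_uniform :: "nat \<Rightarrow> nat \<Rightarrow> nat hypergraph" where
  "complete_uniform k n = ({..<n}, {e. e \<subseteq> {..<n} \<and> card e = k})"

text \<open>The vertices of the cube are the 0/1-strings of length \<open>n\<close>; positions are numbered
  from 0, so that \<open>{..<n}\<close> plays the role of \<open>[n]\<close>.\<close>

definition cube :: "nat \<Rightarrow> bool list hypergraph" where
  "cube n = ({v. length v = n},
     {{u, v} |u v. length u = n \<and> length v = n \<and> card {i. i < n \<and> u ! i \<noteq> v ! i} = 1})"

datatype entry = Zero | One | Star

text \<open>The \<open>i\<close>-th entry of the string denoting a cube edge \<open>e\<close>, read off from its two
  endpoints: they agree at \<open>i\<close> unless \<open>i\<close> is the position of the flip-bit.\<close>

definition edge_entry :: "bool list set \<Rightarrow> nat \<Rightarrow> entry" where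
  "edge_entry e i =
     (if \<forall>v\<in>e. \<not> v ! i then Zero else if \<forall>v\<in>e. v ! i then One else Star)"

definition nonzero_bits :: "nat \<Rightarrow> bool list set \<Rightarrow> nat set" where
  "nonzero_bits l e = {i. i < l \<and> edge_entry e i \<in> {One, Star}}"

text \<open>Here \<open>\<phi>\<close> realises \<open>H\<close> as a subgraph of the \<open>l\<close>-cube, and \<open>R\<close> is the resulting
  hypergraph. All of the \<open>l\<close> positions are vertices of \<open>R\<close>, covered by an edge or not.\<close>

definition partite_representation :: "nat \<Rightarrow> 'a hypergraph \<Rightarrow> nat hypergraph \<Rightarrow> bool" where
  "partite_representation k H R \<longleftrightarrow>
     (\<exists>l \<phi> \<sigma>. embedding \<phi> H (cube l)
        \<and> \<sigma> \<in> {..<l} \<rightarrow> {..<k}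
        \<and> (\<forall>e\<in>edges H. card (nonzero_bits l (\<phi> ` e)) = k
                       \<and> \<sigma> ` nonzero_bits l (\<phi> ` e) = {..<k})
        \<and> R = ({..<l}, (\<lambda>e. nonzero_bits l (\<phi> ` e)) ` edges H))"

end

theory Submission
  imports Defs
begin

text \<open>For a set \<open>V\<close> of positions let \<open>F\<^sub>V\<close> be the hypergraph of the \<open>k\<close>-sets \<open>T\<close> disjoint from \<open>V\<close>
  such that \<open>G\<close> contains all \<open>k\<close> cube edges going down from \<open>V \<union> T\<close> in the directions of \<open>T\<close>. A copy
  of the representation in some \<open>F\<^sub>V\<close> yields a copy of \<open>H\<close> in \<open>G\<close>, translated by \<open>V\<close>; hence each
  \<open>F\<^sub>V\<close> has at most \<open>\<alpha> n\<^sup>k\<close> edges. The \<open>F\<^sub>V\<close> together have as many edges as there are pairs of a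
  cube vertex \<open>S\<close> and a \<open>k\<close>-set of directions going down from \<open>S\<close> in \<open>G\<close>, namely the sum of the
  \<open>d(S) choose k\<close>, where \<open>d(S)\<close> is the down-degree. By convexity the sum of the \<open>d(S)\<close>,
  which is the number of edges of \<open>G\<close>, is \<open>O(\<alpha>\<^bsup>1/k\<^esup> 2\<^sup>n n)\<close>.\<close>

section \<open>Cube vertices and edges as sets of positions\<close>

definition bitvec :: "nat \<Rightarrow> nat set \<Rightarrow> bool list" where
  "bitvec n S = map (\<lambda>i. i \<in> S) [0..<n]"

definition supp :: "bool list \<Rightarrow> nat set" where
  "supp v = {i. i < length v \<and> v ! i}"

definition down_dirs :: "nat \<Rightarrow> bool list hypergraph \<Rightarrow> nat set \<Rightarrow> nat set" where
  "down_dirs n G S = {j \<in> S. {bitvec n S, bitvec n (S - {j})} \<in> edges G}"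

text \<open>The positions in \<open>V\<close> are kept as isolated vertices, so that every link lies
  in \<open>complete_uniform k n\<close> with the same \<open>n\<close>.\<close>

definition link :: "nat \<Rightarrow> nat \<Rightarrow> bool list hypergraph \<Rightarrow> nat set \<Rightarrow> nat hypergraph" where
  "link k n G V =
     ({..<n}, {T. T \<subseteq> {..<n} \<and> card T = k \<and> V \<inter> T = {} \<and> T \<subseteq> down_dirs n G (V \<union> T)})"

lemma length_bitvec [simp]: "length (bitvec n S) = n"
  by (simp add: bitvec_def)

lemma nth_bitvec [simp]: "i < n \<Longrightarrow> bitvec n S ! i \<longleftrightarrow> i \<in> S"
  by (simp add: bitvec_def)

lemma supp_bitvec: "S \<subseteq> {..<n} \<Longrightarrow> supp (bitvec n S) = S"
  by (auto simp: supp_def)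

lemma bitvec_supp: "length v = n \<Longrightarrow> bitvec n (supp v) = v"
  by (auto simp: supp_def intro: nth_equalityI)

lemma supp_subset: "length v = n \<Longrightarrow> supp v \<subseteq> {..<n}"
  by (auto simp: supp_def)

text \<open>The flip-bit \<open>j\<close> orients the edge: \<open>S\<close> is the support of the
  endpoint with a one at \<open>j\<close>, and the other endpoint can only be \<open>S\<close>
  without \<open>j\<close>.\<close>

lemma cube_edgeE:
  assumes "e \<in> edges (cube n)"
  obtains S j where "S \<subseteq> {..<n}" "j \<in> S" "e = {bitvec n S, bitvec n (S - {j})}"
proof -
  obtain u v where e: "e = {u, v}" and len: "length u = n" "length v = n"
    and "card {i. i < n \<and> u ! i \<noteq> v ! i} = 1"
    using assms by (auto simp: cube_def)
  then obtain j where j: "{i. i < n \<and> u ! i \<noteq> v ! i} = {j}"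
    by (auto simp: card_1_singleton_iff)
  note result = that
  have *: thesis if e: "e = {x, y}" and len: "length x = n" "length y = n"
    and d: "{i. i < n \<and> x ! i \<noteq> y ! i} = {j}" and xj: "x ! j" for x y
  proof (rule result)
    have jn: "j < n" "x ! j \<noteq> y ! j" using d by blast+
    then show "j \<in> supp x" using xj len by (simp add: supp_def)
    show "supp x \<subseteq> {..<n}" using len(1) by (rule supp_subset)
    have "y = bitvec n (supp x - {j})"
      using d jn xj len by (intro nth_equalityI) (auto simp: supp_def)
    then show "e = {bitvec n (supp x), bitvec n (supp x - {j})}"
      using e len by (simp add: bitvec_supp)
  qed
  have "u ! j \<noteq> v ! j" using j by blast
  then consider "u ! j" | "v ! j" by blast
  then show thesis
  proof cases
    case 1
    show ?thesis by (rule *[OF e len j 1])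
  next
    case 2
    have "{i. i < n \<and> v ! i \<noteq> u ! i} = {j}" using j by auto
    moreover have "e = {v, u}" using e by blast
    ultimately show ?thesis using * len 2 by blast
  qed
qed

lemma nonzero_bits_bitvec:
  assumes "S \<subseteq> {..<n}"
  shows "nonzero_bits n {bitvec n S, bitvec n (S - {j})} = S"
  using assms by (auto simp: nonzero_bits_def edge_entry_def split: if_splits)

lemma finite_verts_cube: "finite (verts (cube n))"
  using finite_lists_length_eq[of "UNIV :: bool set" n] by (simp add: cube_def)

section \<open>Double counting over the cube\<close>

text \<open>Every edge arises from its upper endpoint and its direction, so the pairs
  \<open>(S, j)\<close> map onto the edges; surjectivity suffices for the inequality.\<close>

lemma card_edges_le_sum_down_dirs:
  assumes "subhypergraph G (cube n)"
  shows "card (edges G) \<le> (\<Sum>S\<in>Pow {..<n}. card (down_dirs n G S))"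
proof -
  let ?A = "Sigma (Pow {..<n}) (down_dirs n G)"
  let ?h = "\<lambda>(S, j). {bitvec n S, bitvec n (S - {j})}"
  have fin: "finite (down_dirs n G S)" if "S \<in> Pow {..<n}" for S
    by (rule finite_subset[of _ "{..<n}"]) (use that in \<open>auto simp: down_dirs_def\<close>)
  have "edges G \<subseteq> ?h ` ?A"
  proof
    fix e assume e: "e \<in> edges G"
    then have "e \<in> edges (cube n)" using assms by (auto simp: subhypergraph_def)
    then obtain S j where "S \<subseteq> {..<n}" "j \<in> S" "e = {bitvec n S, bitvec n (S - {j})}"
      by (rule cube_edgeE)
    with e show "e \<in> ?h ` ?A"
      by (intro image_eqI[of _ _ "(S, j)"]) (auto simp: down_dirs_def)
  qed
  then have "card (edges G) \<le> card ?A"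
    using fin by (intro surj_card_le) auto
  also have "\<dots> = (\<Sum>S\<in>Pow {..<n}. card (down_dirs n G S))"
    using fin by (intro card_SigmaI) auto
  finally show ?thesis .
qed

text \<open>A pair \<open>(S, T)\<close> is regrouped by its lower set \<open>V = S - T\<close>. As
  \<open>T\<close> lies in \<open>S\<close>, the union of \<open>V\<close> and \<open>T\<close>
  gives \<open>S\<close> back, so no two pairs are merged.\<close>

lemma sum_choose_down_dirs_le_sum_link:
  "(\<Sum>S\<in>Pow {..<n}. card (down_dirs n G S) choose k) \<le> (\<Sum>V\<in>Pow {..<n}. card (edges (link k n G V)))"
proof -
  let ?K = "\<lambda>S. {T. T \<subseteq> down_dirs n G S \<and> card T = k}"
  let ?h = "\<lambda>(S, T). (S - T, T)"
  have sub: "down_dirs n G S \<subseteq> S" for S by (auto simp: down_dirs_def)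
  have fin: "finite (down_dirs n G S)" if "S \<in> Pow {..<n}" for S
    using that sub by (meson PowD finite_lessThan finite_subset)
  have finK: "finite (?K S)" if "S \<in> Pow {..<n}" for S
    by (rule finite_subset[of _ "Pow (down_dirs n G S)"]) (use fin[OF that] in auto)
  have finL: "finite (edges (link k n G V))" for V
    by (rule finite_subset[of _ "Pow {..<n}"]) (auto simp: link_def)
  have "(\<Sum>S\<in>Pow {..<n}. card (down_dirs n G S) choose k) = (\<Sum>S\<in>Pow {..<n}. card (?K S))"
    using fin by (intro sum.cong refl) (simp add: n_subsets)
  also have "\<dots> = card (Sigma (Pow {..<n}) ?K)"
    using finK by (subst card_SigmaI) auto
  also have "\<dots> \<le> card (Sigma (Pow {..<n}) (\<lambda>V. edges (link k n G V)))"
  proof (rule card_inj_on_le)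
    have sub': "T \<subseteq> S" if "T \<subseteq> down_dirs n G S" for S T
      using that sub by blast
    show "inj_on ?h (Sigma (Pow {..<n}) ?K)"
      by (rule inj_onI) (use sub' in \<open>clarsimp, metis Diff_partition\<close>)
    show "?h ` Sigma (Pow {..<n}) ?K \<subseteq> Sigma (Pow {..<n}) (\<lambda>V. edges (link k n G V))"
    proof clarsimp
      fix S T assume S: "S \<subseteq> {..<n}" and T: "T \<subseteq> down_dirs n G S" "k = card T"
      have "S - T \<union> T = S" using sub'[OF T(1)] by blast
      then show "S - T \<subseteq> {..<n} \<and> T \<in> edges (link (card T) n G (S - T))"
        using S T sub'[OF T(1)] by (auto simp: link_def)
    qed
    show "finite (Sigma (Pow {..<n}) (\<lambda>V. edges (link k n G V)))"
      using finL by auto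
  qed
  also have "\<dots> = (\<Sum>V\<in>Pow {..<n}. card (edges (link k n G V)))"
    using finL by (intro card_SigmaI) auto
  finally show ?thesis .
qed

section \<open>Lifting copies from the links to the cube\<close>

text \<open>The map \<open>g\<close> may send isolated vertices of \<open>H\<close> outside
  \<open>verts G\<close>. Covered vertices are safe, because their edges go to edges of
  \<open>G\<close>; the isolated ones are rerouted by \<open>h\<close> to vertices of
  \<open>G\<close> still free.\<close>

lemma contains_copyI:
  assumes fin: "finite (verts H)" and le: "card (verts H) \<le> card (verts G)"
    and finG: "finite (verts G)"
    and H: "\<And>e. e \<in> edges H \<Longrightarrow> e \<subseteq> verts H" and G: "\<And>e. e \<in> edges G \<Longrightarrow> e \<subseteq> verts G"
    and g: "inj_on g (verts H)" "\<And>e. e \<in> edges H \<Longrightarrow> g ` e \<in> edges G"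
  shows "contains_copy G H"
proof -
  define W where "W = \<Union>(edges H)"
  have W: "W \<subseteq> verts H" using H by (auto simp: W_def)
  have gW: "g ` W \<subseteq> verts G" using g(2) G by (fastforce simp: W_def)
  have gi: "inj_on g W" using g(1) W by (rule inj_on_subset)
  have finW: "finite W" using W fin by (rule finite_subset)
  \<comment> \<open>Being injective, \<open>g\<close> occupies as many vertices of \<open>G\<close>
    as there are in \<open>W\<close>, so the remainder has room.\<close>
  have "card (verts H - W) \<le> card (verts G - g ` W)"
    using W gW gi le finW by (simp add: card_Diff_subset card_image)
  then obtain h where h: "h ` (verts H - W) \<subseteq> verts G - g ` W" "inj_on h (verts H - W)"
    using card_le_inj[of "verts H - W" "verts G - g ` W"] fin finG by auto
  define f where "f x = (if x \<in> W then g x else h x)" for x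
  have "inj_on f (W \<union> (verts H - W))"
    unfolding inj_on_Un
  proof (intro conjI)
    show "inj_on f W" using gi by (simp add: f_def inj_on_def)
    show "inj_on f (verts H - W)" using h(2) by (simp add: f_def inj_on_def)
    show "f ` (W - (verts H - W)) \<inter> f ` (verts H - W - W) = {}"
      using h(1) by (auto simp: f_def)
  qed
  moreover have "W \<union> (verts H - W) = verts H" using W by blast
  moreover have "f ` verts H \<subseteq> verts G" using h(1) gW by (auto simp: f_def)
  moreover have "f ` e \<in> edges G" if e: "e \<in> edges H" for e
  proof -
    have "f ` e = g ` e" using e by (intro image_cong) (auto simp: f_def W_def)
    then show ?thesis using g(2)[OF e] by simp
  qed
  ultimately show ?thesis unfolding contains_copy_def embedding_def by metis
qed

text \<open>The symmetric difference with \<open>V\<close>, unlike the union, is injective even if the copy of the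
  representation maps some of its isolated vertices into \<open>V\<close>. The hypothesis on the
  cardinalities makes room for the isolated vertices of \<open>H\<close>.\<close>

lemma contains_copy_of_link:
  assumes \<phi>: "embedding \<phi> H (cube l)"
    and R: "R = ({..<l}, (\<lambda>e. nonzero_bits l (\<phi> ` e)) ` edges H)"
    and copy: "contains_copy (link k n G V) R"
    and H: "finite (verts H)" "\<And>e. e \<in> edges H \<Longrightarrow> e \<subseteq> verts H"
    and G: "subhypergraph G (cube n)"
    and le: "card (verts H) \<le> card (verts G)"
    and V: "V \<subseteq> {..<n}"
  shows "contains_copy G H"
proof -
  obtain f where f: "inj_on f {..<l}" "f ` {..<l} \<subseteq> {..<n}"
    and fe: "\<And>e. e \<in> edges H \<Longrightarrow> f ` nonzero_bits l (\<phi> ` e) \<in> edges (link k n G V)"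
    using copy by (auto simp: contains_copy_def embedding_def R link_def)
  define \<psi> where "\<psi> x = bitvec n (sym_diff V (f ` supp x))" for x
  have len: "length (\<phi> x) = l" if "x \<in> verts H" for x
    using \<phi> that by (auto simp: embedding_def cube_def)
  show ?thesis
  proof (rule contains_copyI[OF H(1) le])
    show "finite (verts G)"
      using G finite_verts_cube by (auto simp: subhypergraph_def intro: finite_subset)
    show "e \<subseteq> verts G" if "e \<in> edges G" for e
      using G that by (auto simp: subhypergraph_def)
    show "inj_on (\<psi> \<circ> \<phi>) (verts H)"
    proof (rule comp_inj_on)
      show "inj_on \<phi> (verts H)" using \<phi> by (simp add: embedding_def)
      show "inj_on \<psi> (\<phi> ` verts H)"
      proof (rule inj_onI)
        fix x y assume "x \<in> \<phi> ` verts H" "y \<in> \<phi> ` verts H" and eq: "\<psi> x = \<psi> y"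
        then have x: "length x = l" and y: "length y = l" using len by auto
        note sx = supp_subset[OF x] and sy = supp_subset[OF y]
        have "sym_diff V (f ` supp z) \<subseteq> {..<n}" if "supp z \<subseteq> {..<l}" for z
          using that f(2) V by blast
        then have "sym_diff V (f ` supp x) = sym_diff V (f ` supp y)"
          using eq sx sy unfolding \<psi>_def by (metis supp_bitvec)
        then have "f ` supp x = f ` supp y" by blast
        then have "supp x = supp y"
          using inj_on_image_eq_iff[OF f(1) sx sy] by simp
        then show "x = y" using bitvec_supp x y by metis
      qed
    qed
    show "(\<psi> \<circ> \<phi>) ` e \<in> edges G" if e: "e \<in> edges H" for e
    proof -
      have "\<phi> ` e \<in> edges (cube l)" using \<phi> e by (simp add: embedding_def)
      then obtain S j where S: "S \<subseteq> {..<l}" "j \<in> S"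
        and eq: "\<phi> ` e = {bitvec l S, bitvec l (S - {j})}"
        by (rule cube_edgeE)
      \<comment> \<open>The nonzero bits form the upper endpoint \<open>S\<close>, so the edge of
        the link supplies in particular the downward direction \<open>f j\<close>.\<close>
      have nz: "nonzero_bits l (\<phi> ` e) = S" unfolding eq by (rule nonzero_bits_bitvec[OF S(1)])
      then have d: "V \<inter> f ` S = {}" "f ` S \<subseteq> down_dirs n G (V \<union> f ` S)"
        using fe[OF e] by (auto simp: link_def)
      have S': "S - {j} \<subseteq> {..<l}" using S by blast
      have "f ` (S - {j}) = f ` S - {f j}"
        using inj_on_image_set_diff[OF f(1), of S "{j}"] S by auto
      moreover have "f j \<in> f ` S" using S by blast
      \<comment> \<open>As \<open>V\<close> misses the image of \<open>S\<close>, the symmetric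
        difference is a union on this edge.\<close>
      ultimately have "sym_diff V (f ` S) = V \<union> f ` S"
        and "sym_diff V (f ` (S - {j})) = V \<union> f ` S - {f j}"
        using d(1) by auto
      then have "(\<psi> \<circ> \<phi>) ` e = {bitvec n (V \<union> f ` S), bitvec n (V \<union> f ` S - {f j})}"
        unfolding image_comp[symmetric] eq by (simp add: \<psi>_def supp_bitvec[OF S(1)] supp_bitvec[OF S'])
      then show ?thesis using d(2) S(2) by (auto simp: down_dirs_def)
    qed
  qed (use H in auto)
qed

section \<open>Bounds on extremal numbers\<close>

lemma card_edges_le_ex_number:
  assumes "subhypergraph F G" "\<not> contains_copy F H" "finite (edges G)"
  shows "card (edges F) \<le> ex_number G H"
  unfolding ex_number_def
proof (rule cSup_upper)
  show "bdd_above {card (edges F) |F. subhypergraph F G \<and> \<not> contains_copy F H}"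
    by (rule bdd_aboveI[of _ "card (edges G)"])
      (use assms(3) in \<open>auto simp: subhypergraph_def intro: card_mono\<close>)
  show "card (edges F) \<in> {card (edges F) |F. subhypergraph F G \<and> \<not> contains_copy F H}"
    using assms(1,2) by blast
qed

lemma ex_number_le:
  fixes B :: real
  assumes "\<And>F. subhypergraph F G \<Longrightarrow> \<not> contains_copy F H \<Longrightarrow> real (card (edges F)) \<le> B"
    and "0 \<le> B"
  shows "real (ex_number G H) \<le> B"
proof (cases "{card (edges F) |F. subhypergraph F G \<and> \<not> contains_copy F H} = {}")
  \<comment> \<open>The supremum of the empty set of naturals is 0, hence the hypothesis
    \<open>0 \<le> B\<close>.\<close>
  case True
  then show ?thesis using assms(2) unfolding ex_number_def True by simp
next
  case False
  have "ex_number G H \<le> nat \<lfloor>B\<rfloor>"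
    unfolding ex_number_def
    by (rule cSup_least[OF False]) (use assms(1) in \<open>fastforce simp: le_nat_floor\<close>)
  then show ?thesis using assms(2) by linarith
qed

section \<open>Convexity and averaging\<close>

text \<open>Summed over the vertices of the cube, this replaces Jensen's inequality.\<close>

lemma le_choose_linear:
  fixes t :: real
  assumes "k \<ge> 1" "t > 0"
  shows "real d \<le> k + k * t + k * t * (real (d choose k) / t ^ k)"
proof (cases "d < k")
  case True
  then have "real d \<le> k" by simp
  moreover have "0 \<le> k * t + k * t * (real (d choose k) / t ^ k)" using assms by simp
  ultimately show ?thesis by linarith
next
  case False
  \<comment> \<open>The scale \<open>k * t\<close> makes \<open>y ^ k\<close> at most
    \<open>(d choose k) / t ^ k\<close>. The binomial bound requires \<open>k \<le> d\<close>;
    smaller \<open>d\<close> are absorbed by the summand \<open>k\<close>.\<close>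
  define y where "y = real d / (k * t)"
  have "(real d / k) ^ k \<le> real (d choose k)"
    using binomial_ge_n_over_k_pow_k[of k d, where 'a = real] False by simp
  then have le: "y ^ k \<le> real (d choose k) / t ^ k"
    using assms by (simp add: y_def power_divide power_mult_distrib field_simps)
  have "y \<ge> 0" using assms by (simp add: y_def)
  then have "y \<le> 1 + y ^ k"
  proof (cases "y \<le> 1")
    case False
    then show ?thesis using assms(1) self_le_power[of y k] by simp
  qed (simp add: add_increasing2)
  then have "k * t * y \<le> k * t * (1 + real (d choose k) / t ^ k)"
    using le assms by (intro mult_left_mono) auto
  moreover have "k * t * y = d" using assms by (simp add: y_def)
  ultimately show ?thesis by (simp add: algebra_simps)
qed

text \<open>There are \<open>2 ^ n\<close> sets \<open>V\<close>, as many as vertices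
  \<open>S\<close>, so the bound on the links makes \<open>(d choose k) / t ^ k\<close> at most 1 on
  average over the cube.\<close>

lemma card_edges_le_of_card_link_le:
  fixes t :: real
  assumes G: "subhypergraph G (cube n)" and "k \<ge> 1" "t > 0"
    and link: "\<And>V. V \<subseteq> {..<n} \<Longrightarrow> real (card (edges (link k n G V))) \<le> t ^ k"
  shows "real (card (edges G)) \<le> (real k + 2 * real k * t) * 2 ^ n"
proof -
  let ?P = "Pow {..<n}"
  let ?d = "\<lambda>S. card (down_dirs n G S)"
  have "real (\<Sum>S\<in>?P. ?d S choose k) \<le> real (\<Sum>V\<in>?P. card (edges (link k n G V)))"
    by (rule of_nat_mono) (rule sum_choose_down_dirs_le_sum_link)
  also have "\<dots> \<le> (\<Sum>V\<in>?P. t ^ k)"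
    unfolding of_nat_sum using link by (intro sum_mono) auto
  also have "\<dots> = 2 ^ n * t ^ k" by (simp add: card_Pow)
  finally have *: "(\<Sum>S\<in>?P. real (?d S choose k)) / t ^ k \<le> 2 ^ n"
    using \<open>t > 0\<close> by (simp add: field_simps)
  have "real (card (edges G)) \<le> (\<Sum>S\<in>?P. real (?d S))"
    using of_nat_mono[OF card_edges_le_sum_down_dirs[OF G], where 'a = real] by simp
  also have "\<dots> \<le> (\<Sum>S\<in>?P. k + k * t + k * t * (real (?d S choose k) / t ^ k))"
    using assms by (intro sum_mono le_choose_linear)
  also have "\<dots> = (k + k * t) * 2 ^ n + k * t * ((\<Sum>S\<in>?P. real (?d S choose k)) / t ^ k)"
    by (simp add: sum.distrib card_Pow sum_divide_distrib sum_distrib_left algebra_simps)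
  also have "\<dots> \<le> (k + k * t) * 2 ^ n + k * t * 2 ^ n"
    using * \<open>t > 0\<close> by (intro add_left_mono mult_left_mono) auto
  also have "\<dots> = (real k + 2 * real k * t) * 2 ^ n" by (simp add: algebra_simps)
  finally show ?thesis .
qed

section \<open>The bound for large n\<close>

theorem theorem2p2:
  fixes k :: nat
  assumes "k \<ge> 1"
  shows "\<exists>C::real. \<forall>(m::nat) (H::bool list hypergraph) (R::nat hypergraph) (\<alpha>::real).
           subhypergraph H (cube m) \<longrightarrow>
           partite_representation k H R \<longrightarrow>
           \<alpha> > 0 \<longrightarrow>
           (\<forall>n. real (ex_number (complete_uniform k n) R) \<le> \<alpha> * real n ^ k) \<longrightarrow>
           (\<exists>N. \<forall>n\<ge>N. real (ex_number (cube n) H)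
                        \<le> C * \<alpha> powr (1 / real k) * 2 ^ n * real n)"
proof (intro exI[of _ "3 * real k"] allI impI)
  fix m :: nat and H :: "bool list hypergraph" and R :: "nat hypergraph" and \<alpha> :: real
  assume H: "subhypergraph H (cube m)" and rep: "partite_representation k H R"
    and \<alpha>: "\<alpha> > 0"
    and exR: "\<forall>n. real (ex_number (complete_uniform k n) R) \<le> \<alpha> * real n ^ k"
  obtain l \<phi> where \<phi>: "embedding \<phi> H (cube l)"
    and R: "R = ({..<l}, (\<lambda>e. nonzero_bits l (\<phi> ` e)) ` edges H)"
    using rep unfolding partite_representation_def by blast
  have finH: "finite (verts H)"
    using H finite_verts_cube by (auto simp: subhypergraph_def intro: finite_subset)
  have subH: "\<And>e. e \<in> edges H \<Longrightarrow> e \<subseteq> verts H"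
    using H by (auto simp: subhypergraph_def)
  define b where "b = \<alpha> powr (1 / real k)"
  have b: "b > 0" using \<alpha> by (simp add: b_def)
  have bk: "b ^ k = \<alpha>"
    using \<alpha> assms by (simp add: b_def powr_realpow[symmetric] powr_powr)
  \<comment> \<open>For \<open>n \<ge> N0\<close> the number \<open>t = b * n\<close> is at least 1,
    so \<open>k + 2 * k * t\<close> is at most \<open>3 * k * t\<close>; this gives the constant.
    Its power \<open>t ^ k\<close> is \<open>\<alpha> * n ^ k\<close>, the bound for a link.\<close>
  obtain N0 :: nat where N0: "1 / b \<le> real N0" using real_arch_simple by blast
  show "\<exists>N. \<forall>n\<ge>N. real (ex_number (cube n) H)
          \<le> 3 * real k * \<alpha> powr (1 / real k) * 2 ^ n * real n"
    unfolding b_def[symmetric]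
  proof (intro exI[of _ "max N0 (card (verts H))"] allI impI)
    fix n assume "max N0 (card (verts H)) \<le> n"
    then have n: "N0 \<le> n" "card (verts H) \<le> n" by auto
    define t where "t = b * real n"
    have "1 / b \<le> real n" using N0 n(1) by linarith
    then have t: "1 \<le> t" using b by (simp add: t_def field_simps)
    have kt: "1 \<le> real k * t" using mult_mono[of 1 "real k" 1 t] assms t by simp
    have "real (ex_number (cube n) H) \<le> 3 * real k * t * 2 ^ n"
    proof (rule ex_number_le)
      fix G assume G: "subhypergraph G (cube n)" and free: "\<not> contains_copy G H"
      have finG: "finite (verts G)"
        using G finite_verts_cube by (auto simp: subhypergraph_def intro: finite_subset)
      show "real (card (edges G)) \<le> 3 * real k * t * 2 ^ n"
      proof (cases "card (verts H) \<le> card (verts G)")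
        case True
        have "real (card (edges G)) \<le> (real k + 2 * real k * t) * 2 ^ n"
        proof (rule card_edges_le_of_card_link_le[OF G assms])
          fix V assume V: "V \<subseteq> {..<n}"
          have "subhypergraph (link k n G V) (complete_uniform k n)"
            by (auto simp: subhypergraph_def link_def complete_uniform_def)
          moreover have "\<not> contains_copy (link k n G V) R"
            using contains_copy_of_link[OF \<phi> R _ finH subH G True V] free by blast
          moreover have "finite (edges (complete_uniform k n))"
            by (simp add: complete_uniform_def)
          ultimately have "real (card (edges (link k n G V))) \<le> ex_number (complete_uniform k n) R"
            by (intro of_nat_mono card_edges_le_ex_number)
          also have "\<dots> \<le> t ^ k" using exR bk by (simp add: t_def power_mult_distrib)
          finally show "real (card (edges (link k n G V))) \<le> t ^ k" .
        qed (use t in simp)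
        also have "\<dots> \<le> 3 * real k * t * 2 ^ n"
          using mult_left_mono[OF t, of "real k"] by (intro mult_right_mono) (auto simp: mult.commute)
        finally show ?thesis .
      next
        \<comment> \<open>Lifting a copy requires \<open>G\<close> to have at least as many vertices
          as \<open>H\<close>. Otherwise \<open>G\<close> has fewer than \<open>n\<close> vertices,
          and counting all vertex subsets suffices.\<close>
        case False
        have "edges G \<subseteq> Pow (verts G)" using G by (auto simp: subhypergraph_def)
        then have "card (edges G) \<le> 2 ^ card (verts G)"
          using finG card_mono[of "Pow (verts G)" "edges G"] by (simp add: card_Pow)
        also have "\<dots> \<le> 2 ^ n" using False n(2) by (intro power_increasing) auto
        finally have "real (card (edges G)) \<le> 2 ^ n"
          using of_nat_mono by fastforce
        also have "\<dots> \<le> 3 * real k * t * 2 ^ n" using kt by simp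
        finally show ?thesis .
      qed
    qed (use t in simp)
    then show "real (ex_number (cube n) H) \<le> 3 * real k * b * 2 ^ n * real n"
      by (simp add: t_def mult_ac)
  qed
qed

end
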